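(* Let $V$ be the vector space spanned by the couples $(t,s)$ where $t$ is a rooted tree and $s=P^{c_0}(t)$ is the pruning of $t$ by an admissible cut $c_0$ of $t$. Let $(\mathcal D,m,\Delta)$ be the doubling bialgebra of rooted trees, $\mathcal D=S(V)$, with $$\Delta(t,s)=\sum_{c\in\mathrm{Adm}(s)}\big(t,P^c(s)\big)\otimes\big(R^c(t),R^c(s)\big).$$ Let $(\mathcal D',m,\chi)$ be $\mathcal D'=S(V)$ with the same product $m$ and the unshuffling coproduct $\chi$. Then $(\mathcal D',m,\chi)$ is a comodule-coalgebra on $(\mathcal D,m,\Delta)$, the coaction being $\Delta$ viewed as a map $\mathcal D'\to\mathcal D\otimes\mathcal D'$. That is, $\Delta:\mathcal D'\to\mathcal D\otimes\mathcal D'$ is a (coassociative) left coaction, and $\chi$ is a morphism of left comodules: $$(I\otimes\chi)\circ\Delta=(m\otimes I\otimes I)\circ\tau^{23}\circ(\Delta\otimes\Delta)\circ\chi .$$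
   Context: Rooted trees are finite, non-planar, non-empty. A forest is a finite (possibly empty) disjoint union of rooted trees; $\mathbf 1$ denotes the empty forest. An admissible cut $c$ of a forest is a collection of edges such that any path from a root to a leaf contains at most one edge of the collection. $P^c$ (pruning) denotes the subforest above the cut and $R^c$ (trunk) the part below the cut. For each tree, $\mathrm{Adm}$ also contains the empty cut (pruning $\mathbf 1$, trunk the whole tree) and the total cut (pruning the whole tree, trunk $\mathbf 1$); a cut of a forest is a choice of cut of each of its component trees. In a couple $(t,s)$, $s$ is regarded as a subforest of $t$. For $c\in\mathrm{Adm}(s)$, $P^c(s)$ is also a pruning of $t$, and $R^c(t)$ is what remains of $t$ after removing $P^c(s)$. The product in $S(V)$ is written $m\big((t,s)\otimes(t',s')\big)=(t,s)(t',s')=(tt',ss')$ (disjoint unions), so elements of $S(V)$ are linear combinations of couples $(t,s)$ with $t$ a forest. The unit $\mathbf 1$ is identified with the empty forest (the couple $(\mathbf 1,\mathbf 1)$). $\Delta$ is multiplicative, and the counit of $\mathcal D$ is $\varepsilon(t,s)=\varepsilon(s)$ ($1$ if $s$ is empty, $0$ otherwise). The unshuffling coproduct $\chi$ is the algebra morphism $S(V)\to S(V)\otimes S(V)$ with $\chi(x)=x\otimes\mathbf 1+\mathbf 1\otimes x$ for every $x\in V$. $I$ is the identity, and $\tau^{23}$ exchanges the second and third tensor factors. *)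

theory Defs
  imports "HOL-Library.Multiset" "HOL-Library.Poly_Mapping" "HOL-Library.Product_Plus"
    "HOL-Library.FuncSet"
begin

section \<open>Rooted forests and admissible cuts\<close>

text \<open>A forest is given by its vertex set and its set of edges, oriented from parent to child
  (away from the roots). Isomorphism classes are taken further below.\<close>

type_synonym forest = "nat set \<times> (nat \<times> nat) set"

abbreviation verts :: "forest \<Rightarrow> nat set" where "verts \<equiv> fst"
abbreviation edges :: "forest \<Rightarrow> (nat \<times> nat) set" where "edges \<equiv> snd"

definition is_forest :: "forest \<Rightarrow> bool" where
  "is_forest F \<longleftrightarrow> finite (verts F) \<and> edges F \<subseteq> verts F \<times> verts F \<and> acyclic (edges F) \<and>
     single_valued ((edges F)\<inverse>)"

definition roots :: "forest \<Rightarrow> nat set" where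
  "roots F = verts F - Range (edges F)"

definition leaves :: "forest \<Rightarrow> nat set" where
  "leaves F = verts F - Domain (edges F)"

definition is_tree :: "forest \<Rightarrow> bool" where
  "is_tree F \<longleftrightarrow> is_forest F \<and> (\<exists>r. roots F = {r})"

definition subforest :: "forest \<Rightarrow> nat set \<Rightarrow> forest" where
  "subforest F W = (verts F \<inter> W, edges F \<inter> W \<times> W)"

definition component :: "forest \<Rightarrow> nat \<Rightarrow> forest" where
  "component F r = subforest F ((edges F)\<^sup>* `` {r})"

definition root_leaf_path :: "forest \<Rightarrow> nat list \<Rightarrow> bool" where
  "root_leaf_path F p \<longleftrightarrow> p \<noteq> [] \<and> hd p \<in> roots F \<and> last p \<in> leaves F \<and>
     successively (\<lambda>u v. (u, v) \<in> edges F) p"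

definition path_edges :: "nat list \<Rightarrow> (nat \<times> nat) set" where
  "path_edges p = set (zip p (tl p))"

definition admissible :: "forest \<Rightarrow> (nat \<times> nat) set \<Rightarrow> bool" where
  "admissible F c \<longleftrightarrow> c \<subseteq> edges F \<and> (\<forall>p. root_leaf_path F p \<longrightarrow> card (c \<inter> path_edges p) \<le> 1)"

text \<open>\<open>Edges {}\<close> is the empty cut.\<close>

datatype cut = Edges "(nat \<times> nat) set" | Total

definition tree_cuts :: "forest \<Rightarrow> cut set" where
  "tree_cuts T = insert Total (Edges ` {c. admissible T c})"

text \<open>Prunings are represented by their vertex sets; the vertices above a cut are those that can
  be reached from the upper end of one of its edges.\<close>

fun tree_pruning :: "forest \<Rightarrow> cut \<Rightarrow> nat set" where
  "tree_pruning T (Edges c) = (edges T)\<^sup>* `` (snd ` c)"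
| "tree_pruning T Total = verts T"

definition Adm :: "forest \<Rightarrow> (nat \<Rightarrow> cut) set" where
  "Adm F = (\<Pi>\<^sub>E r\<in>roots F. tree_cuts (component F r))"

definition pruning :: "forest \<Rightarrow> (nat \<Rightarrow> cut) \<Rightarrow> nat set" where
  "pruning F c = (\<Union>r\<in>roots F. tree_pruning (component F r) (c r))"


section \<open>Couples\<close>

text \<open>A couple consists of a tree \<open>T\<close> and the vertex set \<open>S\<close> of a subforest that is the pruning
  of \<open>T\<close> by an admissible cut, that is, by an admissible (possibly empty) collection of edges.
  In particular \<open>S\<close> does not contain the root of \<open>T\<close>. (The total cut only occurs as an
  element of \<open>Adm\<close>. If \<open>S = verts T\<close> were allowed, \<open>\<chi>\<close> would not be a morphism of comodules:
  for the one-vertex tree the two sides would contain \<open>(t, t) \<otimes> \<one> \<otimes> \<one>\<close> with coefficients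
  1 and 2.)\<close>

fun is_couple :: "forest \<times> nat set \<Rightarrow> bool" where
  "is_couple (T, S) \<longleftrightarrow> is_tree T \<and> (\<exists>c. admissible T c \<and> S = tree_pruning T (Edges c))"

fun couple_iso :: "forest \<times> nat set \<Rightarrow> forest \<times> nat set \<Rightarrow> bool" where
  "couple_iso (T, S) (T', S') \<longleftrightarrow> is_couple (T, S) \<and> is_couple (T', S') \<and>
     (\<exists>f. bij_betw f (verts T) (verts T') \<and> map_prod f f ` edges T = edges T' \<and> f ` S = S')"

declare is_couple.simps [simp del] couple_iso.simps [simp del]

lemma path_edges_append:
  assumes "p \<noteq> []" "q \<noteq> []"
  shows "path_edges (p @ q) = insert (last p, hd q) (path_edges p \<union> path_edges q)"
  using assms
proof (induction p)
  case (Cons x p)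
  show ?case
  proof (cases p)
    case Nil
    then show ?thesis using Cons.prems by (cases q) (auto simp: path_edges_def)
  next
    case (Cons y p')
    then show ?thesis using Cons.IH \<open>q \<noteq> []\<close> by (auto simp: path_edges_def)
  qed
qed simp

lemma rtrancl_path:
  assumes "(a, b) \<in> E\<^sup>*"
  shows "\<exists>p. p \<noteq> [] \<and> hd p = a \<and> last p = b \<and> successively (\<lambda>u v. (u, v) \<in> E) p"
  using assms
proof (induction rule: converse_rtrancl_induct)
  case base
  then show ?case by (intro exI[of _ "[b]"]) auto
next
  case (step y z)
  then obtain p where "p \<noteq> []" "hd p = z" "last p = b" "successively (\<lambda>u v. (u, v) \<in> E) p"
    by blast
  with step show ?case by (intro exI[of _ "y # p"]) (auto simp: successively_Cons)
qed

lemma path_closed: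
  assumes "E `` S \<subseteq> S" "successively (\<lambda>u v. (u, v) \<in> E) p" "p \<noteq> []" "hd p \<in> S"
  shows "set p \<subseteq> S"
  using assms(2-4)
proof (induction p)
  case (Cons x p)
  then show ?case using assms(1) by (cases p) auto
qed simp

lemma rtrancl_closed: "E `` S \<subseteq> S \<Longrightarrow> a \<in> S \<Longrightarrow> (a, b) \<in> E\<^sup>* \<Longrightarrow> b \<in> S"
  by (metis Image_closed_trancl ImageI)

lemma tree_pruning_step:
  assumes "u \<in> tree_pruning F (Edges c)" "(u, v) \<in> edges F"
  shows "v \<in> tree_pruning F (Edges c)"
  using assms unfolding tree_pruning.simps Image_iff by (meson rtrancl.rtrancl_into_rtrancl)

lemma forest_finite_edges: "is_forest F \<Longrightarrow> finite (edges F)"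
  unfolding is_forest_def by (meson finite_SigmaI finite_subset)

lemma forest_wf: "is_forest F \<Longrightarrow> wf (edges F)" "is_forest F \<Longrightarrow> wf ((edges F)\<inverse>)"
  using forest_finite_edges finite_acyclic_wf finite_acyclic_wf_converse
  unfolding is_forest_def by blast+

lemma forest_root_reach:
  assumes "is_forest F" "v \<in> verts F"
  shows "\<exists>r\<in>roots F. (r, v) \<in> (edges F)\<^sup>*"
  using forest_wf(1)[OF assms(1)] assms(2)
proof (induction v)
  case (less v)
  show ?case
  proof (cases "v \<in> roots F")
    case False
    then obtain u where u: "(u, v) \<in> edges F" using less.prems by (auto simp: roots_def)
    with assms(1) have "u \<in> verts F" by (auto simp: is_forest_def)
    with less.IH[OF u] u show ?thesis by (meson rtrancl.rtrancl_into_rtrancl)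
  qed auto
qed

lemma forest_leaf_reach:
  assumes "is_forest F" "v \<in> verts F"
  shows "\<exists>l\<in>leaves F. (v, l) \<in> (edges F)\<^sup>*"
  using forest_wf(2)[OF assms(1)] assms(2)
proof (induction v)
  case (less v)
  show ?case
  proof (cases "v \<in> leaves F")
    case False
    then obtain u where u: "(v, u) \<in> edges F" using less.prems by (auto simp: leaves_def)
    with assms(1) have "u \<in> verts F" by (auto simp: is_forest_def)
    with less.IH[of u] u show ?thesis by (meson converse_rtrancl_into_rtrancl converseI)
  qed auto
qed

lemma admissible_antichain:
  assumes F: "is_forest F" and c: "admissible F c"
    and ab: "(a, b) \<in> c" and uv: "(u, v) \<in> c" and bu: "(b, u) \<in> (edges F)\<^sup>*"
  shows False
proof -
  let ?P = "successively (\<lambda>u v. (u, v) \<in> edges F)"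
  have E: "(a, b) \<in> edges F" "(u, v) \<in> edges F" using c ab uv by (auto simp: admissible_def)
  then have V: "a \<in> verts F" "v \<in> verts F" using F by (auto simp: is_forest_def)
  obtain r where r: "r \<in> roots F" "(r, a) \<in> (edges F)\<^sup>*" using forest_root_reach[OF F V(1)] by blast
  obtain l where l: "l \<in> leaves F" "(v, l) \<in> (edges F)\<^sup>*" using forest_leaf_reach[OF F V(2)] by blast
  obtain p where p: "p \<noteq> []" "hd p = r" "last p = a" "?P p" using rtrancl_path[OF r(2)] by blast
  obtain q where q: "q \<noteq> []" "hd q = b" "last q = u" "?P q" using rtrancl_path[OF bu] by blast
  obtain w where w: "w \<noteq> []" "hd w = v" "last w = l" "?P w" using rtrancl_path[OF l(2)] by blast
  have path: "root_leaf_path F (p @ q @ w)"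
    using p q w r(1) l(1) E by (auto simp: root_leaf_path_def successively_append_iff)
  have "{(a, b), (u, v)} \<subseteq> path_edges (p @ q @ w)"
    using p q w by (auto simp: path_edges_append)
  then have sub: "{(a, b), (u, v)} \<subseteq> c \<inter> path_edges (p @ q @ w)" using ab uv by auto
  have "finite (c \<inter> path_edges (p @ q @ w))" by (simp add: path_edges_def)
  moreover have "card (c \<inter> path_edges (p @ q @ w)) \<le> 1"
    using c path by (auto simp: admissible_def)
  ultimately have "card {(a, b), (u, v)} \<le> 1" using card_mono sub by (meson order_trans)
  then have "b = v" by (auto split: if_splits simp: card_insert_if)
  with bu E(2) have "(b, b) \<in> (edges F)\<^sup>+" by auto
  with F show False by (auto simp: is_forest_def acyclic_def)
qed

definition boundary :: "forest \<Rightarrow> nat set \<Rightarrow> (nat \<times> nat) set" where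
  "boundary F S = {(u, v) \<in> edges F. u \<notin> S \<and> v \<in> S}"

lemma boundary_pruning:
  assumes F: "is_forest F" and c: "admissible F c"
  shows "boundary F (tree_pruning F (Edges c)) = c"
proof -
  have "(u, v) \<in> c" if "(u, v) \<in> boundary F (tree_pruning F (Edges c))" for u v
  proof -
    from that obtain a b where ab: "(a, b) \<in> c" "(b, v) \<in> (edges F)\<^sup>*"
      and uv: "(u, v) \<in> edges F" and u: "u \<notin> tree_pruning F (Edges c)"
      by (force simp: boundary_def)
    from ab(1) c have abE: "(a, b) \<in> edges F" by (auto simp: admissible_def)
    have sv: "x = y" if "(x, z) \<in> edges F" "(y, z) \<in> edges F" for x y z
      using F that by (auto simp: is_forest_def single_valued_def)
    from ab(2) show ?thesis
    proof (cases rule: rtranclE)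
      case base
      then show ?thesis using sv abE uv ab(1) by blast
    next
      case (step y)
      then have "y = u" using sv uv by blast
      with step ab(1) u show ?thesis by force
    qed
  qed
  moreover have "(u, v) \<in> boundary F (tree_pruning F (Edges c))" if "(u, v) \<in> c" for u v
  proof -
    have "u \<notin> tree_pruning F (Edges c)"
      using admissible_antichain[OF F c _ that] by force
    moreover have "v \<in> tree_pruning F (Edges c)" using that by force
    ultimately show ?thesis using that c by (auto simp: boundary_def admissible_def)
  qed
  ultimately show ?thesis by auto
qed

lemma admissible_boundary:
  assumes F: "is_forest F" and S: "edges F `` S \<subseteq> S"
  shows "admissible F (boundary F S)"
proof -
  have "card (boundary F S \<inter> path_edges p) \<le> 1"
    if "successively (\<lambda>u v. (u, v) \<in> edges F) p" for p
    using that
  proof (induction p)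
    case Nil
    then show ?case by (simp add: path_edges_def)
  next
    case (Cons x p)
    show ?case
    proof (cases p)
      case Nil
      then show ?thesis by (simp add: path_edges_def)
    next
      case (Cons y p')
      have pe: "path_edges (x # p) = insert (x, y) (path_edges p)"
        by (simp add: path_edges_def Cons)
      have su: "successively (\<lambda>u v. (u, v) \<in> edges F) p" using Cons.prems Cons by auto
      show ?thesis
      proof (cases "(x, y) \<in> boundary F S")
        case True
        then have "set p \<subseteq> S"
          using path_closed[OF S su] Cons by (auto simp: boundary_def)
        then have "boundary F S \<inter> path_edges p = {}"
          by (auto simp: boundary_def path_edges_def dest: set_zip_leftD)
        then have "boundary F S \<inter> path_edges (x # p) = {(x, y)}" using pe True by auto
        then show ?thesis by simp
      next
        case False
        then have "boundary F S \<inter> path_edges (x # p) = boundary F S \<inter> path_edges p"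
          using pe by auto
        then show ?thesis using Cons.IH su by simp
      qed
    qed
  qed
  then show ?thesis by (auto simp: admissible_def root_leaf_path_def boundary_def)
qed

lemma pruning_boundary:
  assumes F: "is_forest F" and S: "S \<subseteq> verts F" "edges F `` S \<subseteq> S" and r: "roots F \<inter> S = {}"
  shows "tree_pruning F (Edges (boundary F S)) = S"
proof -
  have "v \<in> S" if "v \<in> tree_pruning F (Edges (boundary F S))" for v
    using that rtrancl_closed[OF S(2)] by (auto simp: boundary_def)
  moreover have "v \<in> tree_pruning F (Edges (boundary F S))" if "v \<in> S" for v
    using forest_wf(1)[OF F] that
  proof (induction v)
    case (less v)
    from less.prems S(1) r obtain u where u: "(u, v) \<in> edges F" by (auto simp: roots_def)
    show ?case
    proof (cases "u \<in> S")
      case True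
      from tree_pruning_step[OF less.IH[OF u this] u] show ?thesis .
    next
      case False
      with u less.prems show ?thesis by (force simp: boundary_def)
    qed
  qed
  ultimately show ?thesis by blast
qed

lemma pruning_closed:
  assumes F: "is_forest F" and c: "admissible F c"
  shows "tree_pruning F (Edges c) \<subseteq> verts F" "edges F `` tree_pruning F (Edges c) \<subseteq> tree_pruning F (Edges c)"
    "roots F \<inter> tree_pruning F (Edges c) = {}"
proof -
  have cE: "c \<subseteq> edges F" using c by (auto simp: admissible_def)
  have EV: "edges F \<subseteq> verts F \<times> verts F" using F by (auto simp: is_forest_def)
  have "v \<in> Range (edges F)" if "v \<in> tree_pruning F (Edges c)" for v
  proof -
    from that obtain a b where "(a, b) \<in> c" "(b, v) \<in> (edges F)\<^sup>*" by auto
    with cE show ?thesis by (metis Range.intros rtranclE subsetD)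
  qed
  with EV show "tree_pruning F (Edges c) \<subseteq> verts F" "roots F \<inter> tree_pruning F (Edges c) = {}"
    by (auto simp: roots_def)
  show "edges F `` tree_pruning F (Edges c) \<subseteq> tree_pruning F (Edges c)"
    using tree_pruning_step by blast
qed

lemma is_couple_iff:
  "is_couple (T, S) \<longleftrightarrow> is_tree T \<and> S \<subseteq> verts T \<and> edges T `` S \<subseteq> S \<and> roots T \<inter> S = {}"
proof
  assume "is_couple (T, S)"
  then obtain c where T: "is_tree T" and c: "admissible T c" "S = tree_pruning T (Edges c)"
    unfolding is_couple.simps by blast
  from T have "is_forest T" by (simp add: is_tree_def)
  from T pruning_closed[OF this c(1)] c(2)
  show "is_tree T \<and> S \<subseteq> verts T \<and> edges T `` S \<subseteq> S \<and> roots T \<inter> S = {}" by blast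
next
  assume "is_tree T \<and> S \<subseteq> verts T \<and> edges T `` S \<subseteq> S \<and> roots T \<inter> S = {}"
  then show "is_couple (T, S)"
    using admissible_boundary pruning_boundary unfolding is_couple.simps is_tree_def by metis
qed

lemma tree_cuts_bij:
  assumes T: "is_tree T"
  shows "bij_betw (tree_pruning T) (tree_cuts T) {P. P \<subseteq> verts T \<and> edges T `` P \<subseteq> P}"
proof -
  from T obtain r where F: "is_forest T" and r: "roots T = {r}" by (auto simp: is_tree_def)
  have rV: "r \<in> verts T" using r by (auto simp: roots_def)
  have EV: "edges T \<subseteq> verts T \<times> verts T" using F by (auto simp: is_forest_def)
  have reach: "(r, v) \<in> (edges T)\<^sup>*" if "v \<in> verts T" for v
    using forest_root_reach[OF F that] r by auto
  have ne: "tree_pruning T (Edges c) \<noteq> verts T" if "admissible T c" for c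
    using pruning_closed(3)[OF F that] r rV by blast
  have inj: "inj_on (tree_pruning T) (tree_cuts T)"
  proof (rule inj_onI)
    fix x y assume "x \<in> tree_cuts T" "y \<in> tree_cuts T" "tree_pruning T x = tree_pruning T y"
    then show "x = y"
      using ne boundary_pruning[OF F]
      by (cases x; cases y) (auto simp: tree_cuts_def simp del: tree_pruning.simps(1), metis+)
  qed
  have sub: "tree_pruning T x \<in> {P. P \<subseteq> verts T \<and> edges T `` P \<subseteq> P}" if "x \<in> tree_cuts T" for x
  proof (cases x)
    case (Edges c)
    then have "admissible T c" using that by (auto simp: tree_cuts_def)
    then show ?thesis using pruning_closed[OF F] Edges by blast
  qed (use EV in auto)
  have sur: "P \<in> tree_pruning T ` tree_cuts T" if P: "P \<subseteq> verts T" "edges T `` P \<subseteq> P" for P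
  proof (cases "r \<in> P")
    case True
    then have "P = tree_pruning T Total" using P reach rtrancl_closed[OF P(2)] by auto
    then show ?thesis by (auto simp: tree_cuts_def)
  next
    case False
    then have "P = tree_pruning T (Edges (boundary T P))"
      using pruning_boundary[OF F P] r by auto
    moreover have "Edges (boundary T P) \<in> tree_cuts T"
      using admissible_boundary[OF F P(2)] by (auto simp: tree_cuts_def)
    ultimately show ?thesis by blast
  qed
  show ?thesis unfolding bij_betw_def using inj sub sur by blast
qed

lemma subforest_forest: "is_forest F \<Longrightarrow> is_forest (subforest F W)"
  unfolding is_forest_def subforest_def
  by (auto intro: acyclic_subset simp: single_valued_def)

lemma verts_component:
  assumes F: "is_forest F" and r: "r \<in> verts F"
  shows "verts (component F r) = (edges F)\<^sup>* `` {r}"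
proof -
  have "edges F `` verts F \<subseteq> verts F" using F by (auto simp: is_forest_def)
  from rtrancl_closed[OF this r] show ?thesis by (auto simp: component_def subforest_def)
qed

lemma component_tree:
  assumes F: "is_forest F" and r: "r \<in> roots F"
  shows "is_tree (component F r)"
proof -
  have rV: "r \<in> verts F" "r \<notin> Range (edges F)" using r by (auto simp: roots_def)
  have "v = r" if "v \<in> roots (component F r)" for v
  proof -
    from that have v: "(r, v) \<in> (edges F)\<^sup>*"
      and n: "v \<notin> Range (edges (component F r))"
      using verts_component[OF F rV(1)] by (auto simp: roots_def)
    from v show ?thesis
    proof (cases rule: rtranclE)
      case (step y)
      then have "(y, v) \<in> edges (component F r)" using v by (auto simp: component_def subforest_def)
      with n show ?thesis by auto
    qed simp
  qed
  moreover have "r \<in> roots (component F r)"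
    using rV verts_component[OF F rV(1)] by (auto simp: roots_def component_def subforest_def)
  ultimately have "roots (component F r) = {r}" by blast
  then show ?thesis using subforest_forest[OF F] by (auto simp: is_tree_def component_def)
qed

lemma component_disjoint:
  assumes F: "is_forest F" and r: "r \<in> roots F" "r' \<in> roots F"
    and v: "(r, v) \<in> (edges F)\<^sup>*" "(r', v) \<in> (edges F)\<^sup>*"
  shows "r = r'"
  using v
proof (induction rule: rtrancl_induct)
  case base
  then show ?case using r by (metis DiffE Range.intros roots_def rtranclE)
next
  case (step y z)
  from step.prems show ?case
  proof (cases rule: rtranclE)
    case base
    then show ?thesis using step r by (auto simp: roots_def)
  next
    case (step w)
    then have "w = y" using \<open>(y, z) \<in> edges F\<close> F by (auto simp: is_forest_def single_valued_def)
    with step show ?thesis using step.IH \<open>(r', y) \<in> (edges F)\<^sup>* \<Longrightarrow> r = r'\<close> by simp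
  qed
qed

lemma Adm_bij:
  assumes F: "is_forest F"
  shows "bij_betw (pruning F) (Adm F) {P. P \<subseteq> verts F \<and> edges F `` P \<subseteq> P}"
proof -
  let ?C = "component F"
  let ?U = "\<lambda>r. {P. P \<subseteq> verts (?C r) \<and> edges (?C r) `` P \<subseteq> P}"
  have rV: "r \<in> verts F" if "r \<in> roots F" for r using that by (auto simp: roots_def)
  note vc = verts_component[OF F rV]
  have bij: "bij_betw (tree_pruning (?C r)) (tree_cuts (?C r)) (?U r)" if "r \<in> roots F" for r
    using tree_cuts_bij component_tree[OF F that] by blast
  have inU: "tree_pruning (?C r) (c r) \<in> ?U r" if "c \<in> Adm F" "r \<in> roots F" for c r
  proof -
    have "c r \<in> tree_cuts (?C r)" using that by (auto simp: Adm_def)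
    then show ?thesis by (rule bij_betwE[OF bij[OF that(2)], rule_format])
  qed
  have disj: "r = r'" if "r \<in> roots F" "r' \<in> roots F" "v \<in> verts (?C r)" "v \<in> verts (?C r')" for r r' v
    using component_disjoint[OF F that(1,2)] that(3,4) vc that(1,2) by auto
  have rec: "pruning F c \<inter> verts (?C r) = tree_pruning (?C r) (c r)"
    if c: "c \<in> Adm F" and r: "r \<in> roots F" for c r
  proof
    show "pruning F c \<inter> verts (?C r) \<subseteq> tree_pruning (?C r) (c r)"
    proof
      fix v assume "v \<in> pruning F c \<inter> verts (?C r)"
      then obtain r' where r': "r' \<in> roots F" "v \<in> tree_pruning (?C r') (c r')" "v \<in> verts (?C r)"
        by (auto simp: pruning_def)
      then have "v \<in> verts (?C r')" using inU[OF c r'(1)] by blast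
      then have "r' = r" using disj[OF r'(1) r] r'(3) by blast
      then show "v \<in> tree_pruning (?C r) (c r)" using r' by blast
    qed
    show "tree_pruning (?C r) (c r) \<subseteq> pruning F c \<inter> verts (?C r)"
      using inU[OF c r] r by (auto simp: pruning_def)
  qed
  have inj: "inj_on (pruning F) (Adm F)"
  proof (rule inj_onI)
    fix c d assume cd: "c \<in> Adm F" "d \<in> Adm F" and eq: "pruning F c = pruning F d"
    show "c = d"
    proof (rule PiE_ext)
      show "c \<in> (\<Pi>\<^sub>E r\<in>roots F. tree_cuts (?C r))" "d \<in> (\<Pi>\<^sub>E r\<in>roots F. tree_cuts (?C r))"
        using cd by (auto simp: Adm_def)
      fix r assume r: "r \<in> roots F"
      have "tree_pruning (?C r) (c r) = tree_pruning (?C r) (d r)"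
        using rec[OF cd(1) r] rec[OF cd(2) r] eq by simp
      moreover have "c r \<in> tree_cuts (?C r)" "d r \<in> tree_cuts (?C r)"
        using cd r by (auto simp: Adm_def)
      ultimately show "c r = d r" using bij[OF r] by (auto simp: bij_betw_def inj_on_def)
    qed
  qed
  have sub: "pruning F c \<subseteq> verts F \<and> edges F `` pruning F c \<subseteq> pruning F c" if c: "c \<in> Adm F" for c
  proof -
    have "v \<in> pruning F c" if "u \<in> pruning F c" "(u, v) \<in> edges F" for u v
    proof -
      from that(1) obtain r where r: "r \<in> roots F" "u \<in> tree_pruning (?C r) (c r)"
        by (auto simp: pruning_def)
      note iu = inU[OF c r(1)]
      have u: "u \<in> verts (?C r)" using iu r(2) by blast
      then have u': "(r, u) \<in> (edges F)\<^sup>*" using vc[OF r(1)] by blast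
      then have "(r, v) \<in> (edges F)\<^sup>*" using that(2) by auto
      then have "(u, v) \<in> edges (?C r)" using u' that(2) by (auto simp: component_def subforest_def)
      then have "v \<in> tree_pruning (?C r) (c r)" using iu r(2) by blast
      then show ?thesis using r(1) by (auto simp: pruning_def)
    qed
    moreover have "pruning F c \<subseteq> verts F"
      using inU[OF c] by (fastforce simp: pruning_def component_def subforest_def)
    ultimately show ?thesis by blast
  qed
  have sur: "P \<in> pruning F ` Adm F" if P: "P \<subseteq> verts F" "edges F `` P \<subseteq> P" for P
  proof -
    have "\<exists>x. x \<in> tree_cuts (?C r) \<and> tree_pruning (?C r) x = P \<inter> verts (?C r)" if r: "r \<in> roots F" for r
    proof -
      have "edges (?C r) \<subseteq> verts (?C r) \<times> verts (?C r)" "edges (?C r) \<subseteq> edges F"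
        using component_tree[OF F r]
        by (auto simp: is_tree_def is_forest_def component_def subforest_def)
      then have "P \<inter> verts (?C r) \<in> ?U r" using P(2) by blast
      then show ?thesis using bij[OF r] unfolding bij_betw_def by (metis (no_types, lifting) imageE)
    qed
    then obtain g where g: "\<And>r. r \<in> roots F \<Longrightarrow> g r \<in> tree_cuts (?C r)"
      "\<And>r. r \<in> roots F \<Longrightarrow> tree_pruning (?C r) (g r) = P \<inter> verts (?C r)" by metis
    have A: "restrict g (roots F) \<in> Adm F" using g(1) by (auto simp: Adm_def)
    have "pruning F (restrict g (roots F)) = (\<Union>r\<in>roots F. P \<inter> verts (?C r))"
      using g(2) by (auto simp: pruning_def)
    also have "\<dots> = P"
    proof -
      have "\<exists>r\<in>roots F. v \<in> verts (?C r)" if "v \<in> P" for v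
        using forest_root_reach[OF F] P(1) that vc by blast
      then show ?thesis by blast
    qed
    finally show ?thesis using A by force
  qed
  show ?thesis unfolding bij_betw_def using inj sub sur by blast
qed

lemma couple_Adm_bij:
  assumes "is_couple (T, S)"
  shows "bij_betw (pruning (subforest T S)) (Adm (subforest T S)) {P. P \<subseteq> S \<and> edges T `` P \<subseteq> P}"
proof -
  from assms have T: "is_forest T" and S: "S \<subseteq> verts T" "edges T `` S \<subseteq> S"
    unfolding is_couple_iff is_tree_def by auto
  have "{P. P \<subseteq> verts (subforest T S) \<and> edges (subforest T S) `` P \<subseteq> P}
      = {P. P \<subseteq> S \<and> edges T `` P \<subseteq> P}"
    using S by (auto simp: subforest_def; blast)
  then show ?thesis using Adm_bij[OF subforest_forest[OF T], of S] by simp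
qed

lemma couple_prune:
  assumes c: "is_couple (T, S)" and P: "P \<subseteq> S" "edges T `` P \<subseteq> P"
  shows "is_couple (T, P)" "is_couple (subforest T (verts T - P), S - P)"
proof -
  from c have T: "is_tree T" and S: "S \<subseteq> verts T" "edges T `` S \<subseteq> S" "roots T \<inter> S = {}"
    unfolding is_couple_iff by auto
  show "is_couple (T, P)" unfolding is_couple_iff using T S P by blast
  let ?R = "subforest T (verts T - P)"
  have E: "edges T \<subseteq> verts T \<times> verts T" using T by (auto simp: is_tree_def is_forest_def)
  have "v \<in> Range (edges ?R)" if "(u, v) \<in> edges T" "v \<notin> P" for u v
  proof -
    from that P(2) E have "(u, v) \<in> edges ?R" by (auto simp: subforest_def)
    then show ?thesis by auto
  qed
  then have "roots ?R = roots T"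
    using P(1) S by (auto simp: roots_def subforest_def)
  then show "is_couple (?R, S - P)"
    unfolding is_couple_iff is_tree_def using T S P subforest_forest
    by (auto simp: is_tree_def subforest_def)
qed

lemma couple_iso_cut:
  assumes "couple_iso (T, S) (T', S')"
  shows "\<exists>f. bij_betw ((`) f) {P. P \<subseteq> S \<and> edges T `` P \<subseteq> P} {P. P \<subseteq> S' \<and> edges T' `` P \<subseteq> P} \<and>
    (\<forall>P. P \<subseteq> S \<and> edges T `` P \<subseteq> P \<longrightarrow> couple_iso (T, P) (T', f ` P) \<and>
       couple_iso (subforest T (verts T - P), S - P) (subforest T' (verts T' - f ` P), S' - f ` P))"
proof -
  from assms obtain f where c: "is_couple (T, S)" and c': "is_couple (T', S')"
    and f: "bij_betw f (verts T) (verts T')" and fE: "map_prod f f ` edges T = edges T'"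
    and fS: "f ` S = S'"
    unfolding couple_iso.simps by blast
  from c have S: "S \<subseteq> verts T" and E: "edges T \<subseteq> verts T \<times> verts T"
    unfolding is_couple_iff is_tree_def is_forest_def by auto
  have inj: "inj_on f (verts T)" and im: "f ` verts T = verts T'" using f by (auto simp: bij_betw_def)
  have img: "edges T' `` (f ` P) = f ` (edges T `` P)" if "P \<subseteq> verts T" for P
  proof
    show "edges T' `` (f ` P) \<subseteq> f ` (edges T `` P)"
    proof
      fix y assume "y \<in> edges T' `` (f ` P)"
      then obtain p where p: "p \<in> P" "(f p, y) \<in> edges T'" by auto
      then obtain a b where "(a, b) \<in> edges T" "f a = f p" "y = f b"
        unfolding fE[symmetric] by auto
      moreover then have "a = p" using inj E p that by (auto dest: inj_onD)
      ultimately show "y \<in> f ` (edges T `` P)" using p by auto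
    qed
    show "f ` (edges T `` P) \<subseteq> edges T' `` (f ` P)" unfolding fE[symmetric] by force
  qed
  have closed_iff: "edges T' `` (f ` P) \<subseteq> f ` P \<longleftrightarrow> edges T `` P \<subseteq> P" if "P \<subseteq> verts T" for P
  proof -
    have "edges T `` P \<subseteq> verts T" using E by blast
    then show ?thesis unfolding img[OF that] using inj that unfolding inj_on_def by blast
  qed
  have bij: "bij_betw ((`) f) {P. P \<subseteq> S \<and> edges T `` P \<subseteq> P} {P. P \<subseteq> S' \<and> edges T' `` P \<subseteq> P}"
    unfolding bij_betw_def
  proof
    show "inj_on ((`) f) {P. P \<subseteq> S \<and> edges T `` P \<subseteq> P}"
      using inj_on_image_eq_iff[OF inj] S unfolding inj_on_def by (metis (no_types, lifting) mem_Collect_eq order_trans)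
    show "(`) f ` {P. P \<subseteq> S \<and> edges T `` P \<subseteq> P} = {P. P \<subseteq> S' \<and> edges T' `` P \<subseteq> P}" (is "?L = ?R")
    proof
      show "?L \<subseteq> ?R"
      proof (rule image_subsetI)
        fix P assume "P \<in> {P. P \<subseteq> S \<and> edges T `` P \<subseteq> P}"
        then have P: "P \<subseteq> S" "edges T `` P \<subseteq> P" by simp_all
        have "f ` P \<subseteq> S'" using image_mono[OF P(1), of f] fS by simp
        moreover have "edges T' `` (f ` P) \<subseteq> f ` P"
          using closed_iff[OF order_trans[OF P(1) S]] P(2) by simp
        ultimately show "f ` P \<in> ?R" by simp
      qed
      show "?R \<subseteq> ?L"
      proof
        fix Q assume "Q \<in> ?R"
        then have Q: "Q \<subseteq> f ` S" "edges T' `` Q \<subseteq> Q" using fS by auto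
        then obtain P where P: "P \<subseteq> S" "Q = f ` P" by (meson subset_imageE)
        then have "edges T `` P \<subseteq> P" using closed_iff[of P] Q(2) S by simp
        then have "P \<in> {P. P \<subseteq> S \<and> edges T `` P \<subseteq> P}" using P(1) by simp
        then show "Q \<in> ?L" unfolding P(2) by (rule imageI)
      qed
    qed
  qed
  have isos: "couple_iso (T, P) (T', f ` P) \<and>
       couple_iso (subforest T (verts T - P), S - P) (subforest T' (verts T' - f ` P), S' - f ` P)"
    if P: "P \<subseteq> S" "edges T `` P \<subseteq> P" for P
  proof -
    have PV: "P \<subseteq> verts T" using P S by auto
    have P': "f ` P \<subseteq> S'" "edges T' `` (f ` P) \<subseteq> f ` P"
      using image_mono[OF P(1), of f] fS closed_iff[OF PV] P(2) by simp_all
    note cp = couple_prune[OF c P] and cp' = couple_prune[OF c' P']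
    have "f ` (S - P) = S' - f ` P"
      using inj_on_image_set_diff[OF inj, of S P] S PV fS by (simp add: subset_iff)
    moreover have d: "f ` (verts T - P) = verts T' - f ` P"
      using inj_on_image_set_diff[OF inj, of "verts T" P] PV im by simp
    moreover have "bij_betw f (verts (subforest T (verts T - P))) (verts (subforest T' (verts T' - f ` P)))"
      unfolding subforest_def using d inj
      by (auto simp: bij_betw_def inf_absorb2 intro: inj_on_subset)
    moreover have "map_prod f f ` edges (subforest T (verts T - P)) = edges (subforest T' (verts T' - f ` P))"
    proof
      show "map_prod f f ` edges (subforest T (verts T - P)) \<subseteq> edges (subforest T' (verts T' - f ` P))"
        unfolding subforest_def d[symmetric] fE[symmetric] by force
      show "edges (subforest T' (verts T' - f ` P)) \<subseteq> map_prod f f ` edges (subforest T (verts T - P))"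
      proof
        fix e assume "e \<in> edges (subforest T' (verts T' - f ` P))"
        then obtain a b where ab: "(a, b) \<in> edges T" "e = (f a, f b)" "f a \<notin> f ` P" "f b \<notin> f ` P"
          unfolding subforest_def fE[symmetric] by auto
        then have "a \<notin> P" "b \<notin> P" "a \<in> verts T" "b \<in> verts T" using E by auto
        then have "(a, b) \<in> edges (subforest T (verts T - P))"
          using ab(1) by (auto simp: subforest_def)
        then show "e \<in> map_prod f f ` edges (subforest T (verts T - P))"
          using ab(2) by force
      qed
    qed
    ultimately have "couple_iso (subforest T (verts T - P), S - P)
        (subforest T' (verts T' - f ` P), S' - f ` P)"
      unfolding couple_iso.simps using cp(2) cp'(2) by (intro conjI exI[of _ f])
    moreover have "couple_iso (T, P) (T', f ` P)"
      unfolding couple_iso.simps using cp(1) cp'(1) f fE by (intro conjI exI[of _ f] refl)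
    ultimately show ?thesis by simp
  qed
  show ?thesis by (intro exI[of _ f] conjI allI impI bij) (use isos in simp_all)
qed

lemma couple_iso_sym: "couple_iso x y \<Longrightarrow> couple_iso y x"
proof -
  assume xy: "couple_iso x y"
  obtain T S T' S' where [simp]: "x = (T, S)" "y = (T', S')" by (metis prod.exhaust)
  from xy obtain f where c: "is_couple (T, S)" "is_couple (T', S')"
    and f: "bij_betw f (verts T) (verts T')" and fE: "map_prod f f ` edges T = edges T'"
    and fS: "f ` S = S'"
    by (auto simp: couple_iso.simps)
  from c have S: "S \<subseteq> verts T" and E: "edges T \<subseteq> verts T \<times> verts T"
    unfolding is_couple_iff is_tree_def is_forest_def by auto
  let ?g = "inv_into (verts T) f"
  have inv: "?g (f v) = v" if "v \<in> verts T" for v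
    using f that by (auto simp: bij_betw_def)
  have "bij_betw ?g (verts T') (verts T)" using f by (rule bij_betw_inv_into)
  moreover have "map_prod ?g ?g ` edges T' = edges T"
  proof -
    have "map_prod ?g ?g (map_prod f f e) = e" if "e \<in> edges T" for e
      using that E inv by (cases e) auto
    then show ?thesis unfolding fE[symmetric] image_image by simp
  qed
  moreover have "?g ` S' = S" unfolding fS[symmetric] image_image using S inv by (force simp: subset_iff)
  ultimately show ?thesis using c by (auto simp: couple_iso.simps)
qed

lemma couple_iso_trans: "couple_iso x y \<Longrightarrow> couple_iso y z \<Longrightarrow> couple_iso x z"
proof -
  assume xy: "couple_iso x y" and yz: "couple_iso y z"
  obtain T S T' S' T'' S'' where [simp]: "x = (T, S)" "y = (T', S')" "z = (T'', S'')"
    by (metis prod.exhaust)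
  from xy yz obtain f g where c: "is_couple (T, S)" "is_couple (T'', S'')"
    and "bij_betw f (verts T) (verts T')" "map_prod f f ` edges T = edges T'" "f ` S = S'"
    and "bij_betw g (verts T') (verts T'')" "map_prod g g ` edges T' = edges T''" "g ` S' = S''"
    by (auto simp: couple_iso.simps)
  then have "bij_betw (g \<circ> f) (verts T) (verts T'')" "(g \<circ> f) ` S = S''"
      "map_prod (g \<circ> f) (g \<circ> f) ` edges T = edges T''"
    by (blast intro: bij_betw_trans, simp only: image_comp[symmetric],
        simp only: map_prod.comp[symmetric] image_comp[symmetric])
  then show ?thesis using c unfolding couple_iso.simps \<open>x = _\<close> \<open>z = _\<close> by blast
qed

lemma is_couple_single: "is_couple (({0}, {}), {})"
  by (auto simp: is_couple_iff is_tree_def is_forest_def roots_def acyclic_def)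

lemma couple_iso_part_equivp: "part_equivp couple_iso"
proof (rule part_equivpI)
  have "couple_iso (({0}, {}), {}) (({0}, {}), {})"
    using is_couple_single by (auto simp: couple_iso.simps intro!: exI[of _ id])
  then show "\<exists>x. couple_iso x x" by blast
  show "symp couple_iso" using couple_iso_sym by (rule sympI)
  show "transp couple_iso" using couple_iso_trans by (rule transpI)
qed

text \<open>The basis of \<open>V\<close>: isomorphism classes of couples.\<close>

quotient_type couple = "forest \<times> nat set" / partial: couple_iso
  by (rule couple_iso_part_equivp)

lemma abs_couple_eq: "couple_iso x y \<Longrightarrow> abs_couple x = abs_couple y"
  using Quotient3_couple by (meson Quotient3_rel)


section \<open>Free modules, tensor products and symmetric algebras\<close>

text \<open>The vector space with basis \<open>'a\<close> over the field \<open>'k\<close> is \<open>'a \<Rightarrow>\<^sub>0 'k\<close>; the tensor product of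
  the spaces with bases \<open>'a\<close> and \<open>'b\<close> is the space with basis \<open>'a \<times> 'b\<close>. The symmetric algebra of
  the space with basis \<open>'a\<close> has the monomials \<open>'a multiset\<close> as a basis. Its product, and the
  componentwise product of its tensor powers, are the convolution products of
  \<^theory>\<open>HOL-Library.Poly_Mapping\<close>.\<close>

definition lin_ext :: "('a \<Rightarrow> 'b \<Rightarrow>\<^sub>0 'k::field) \<Rightarrow> ('a \<Rightarrow>\<^sub>0 'k) \<Rightarrow> ('b \<Rightarrow>\<^sub>0 'k)" where
  "lin_ext f p = (\<Sum>a\<in>Poly_Mapping.keys p. Poly_Mapping.map ((*) (Poly_Mapping.lookup p a)) (f a))"

abbreviation basis :: "'a \<Rightarrow> 'a \<Rightarrow>\<^sub>0 'k::field" where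
  "basis a \<equiv> Poly_Mapping.single a 1"

definition tensor :: "('a \<Rightarrow>\<^sub>0 'k::field) \<Rightarrow> ('b \<Rightarrow>\<^sub>0 'k) \<Rightarrow> ('a \<times> 'b \<Rightarrow>\<^sub>0 'k)" where
  "tensor p q = (\<Sum>a\<in>Poly_Mapping.keys p. \<Sum>b\<in>Poly_Mapping.keys q.
     Poly_Mapping.single (a, b) (Poly_Mapping.lookup p a * Poly_Mapping.lookup q b))"

text \<open>The tensor product of two linear maps.\<close>

definition tensor_map :: "(('a \<Rightarrow>\<^sub>0 'k::field) \<Rightarrow> ('c \<Rightarrow>\<^sub>0 'k)) \<Rightarrow> (('b \<Rightarrow>\<^sub>0 'k) \<Rightarrow> ('d \<Rightarrow>\<^sub>0 'k)) \<Rightarrow>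
    ('a \<times> 'b \<Rightarrow>\<^sub>0 'k) \<Rightarrow> ('c \<times> 'd \<Rightarrow>\<^sub>0 'k)" (infixr \<open>\<otimes>\<close> 75) where
  "f \<otimes> g = lin_ext (\<lambda>(a, b). tensor (f (basis a)) (g (basis b)))"

definition assoc :: "(('a \<times> 'b) \<times> 'c \<Rightarrow>\<^sub>0 'k::field) \<Rightarrow> ('a \<times> 'b \<times> 'c \<Rightarrow>\<^sub>0 'k)" where
  "assoc = lin_ext (\<lambda>((a, b), c). basis (a, b, c))"

definition tau23 :: "(('a \<times> 'b) \<times> ('c \<times> 'd) \<Rightarrow>\<^sub>0 'k::field) \<Rightarrow> (('a \<times> 'c) \<times> ('b \<times> 'd) \<Rightarrow>\<^sub>0 'k)" where
  "tau23 = lin_ext (\<lambda>((a, b), (c, d)). basis ((a, c), (b, d)))"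

type_synonym ('a, 'k) sym_alg = "'a multiset \<Rightarrow>\<^sub>0 'k"
type_synonym ('a, 'k) sym_alg2 = "'a multiset \<times> 'a multiset \<Rightarrow>\<^sub>0 'k"

abbreviation gen :: "'a \<Rightarrow> ('a, 'k::field) sym_alg" where
  "gen x \<equiv> basis {#x#}"

text \<open>The algebra morphism out of the symmetric algebra with prescribed values on the generators.\<close>

definition alg_ext :: "('a \<Rightarrow> 'b::comm_monoid_add \<Rightarrow>\<^sub>0 'k::field) \<Rightarrow> ('a, 'k) sym_alg \<Rightarrow> ('b \<Rightarrow>\<^sub>0 'k)" where
  "alg_ext f = lin_ext (\<lambda>M. \<Prod>x\<in>#M. f x)"

definition mult :: "('a, 'k::field) sym_alg2 \<Rightarrow> ('a, 'k) sym_alg" where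
  "mult = lin_ext (\<lambda>(a, b). basis a * basis b)"

definition unshuffle :: "('a, 'k::field) sym_alg \<Rightarrow> ('a, 'k) sym_alg2" where
  "unshuffle = alg_ext (\<lambda>x. tensor (gen x) 1 + tensor 1 (gen x))"


section \<open>The doubling bialgebra\<close>

type_synonym 'k dbl = "(couple, 'k) sym_alg"
type_synonym 'k dbl2 = "(couple, 'k) sym_alg2"

lift_definition coprod_gen :: "couple \<Rightarrow> 'k::field dbl2" is
  "\<lambda>(T, S). \<Sum>c\<in>Adm (subforest T S). let P = pruning (subforest T S) c in
     tensor (gen (abs_couple (T, P))) (gen (abs_couple (subforest T (verts T - P), S - P)))"
proof -
  fix x y assume xy: "couple_iso x y"
  obtain T S T' S' where [simp]: "x = (T, S)" "y = (T', S')" by (metis prod.exhaust)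
  let ?U = "\<lambda>T S. {P. P \<subseteq> S \<and> edges T `` P \<subseteq> P}"
  let ?h = "\<lambda>T S P. tensor (gen (abs_couple (T, P))) (gen (abs_couple (subforest T (verts T - P), S - P))) :: 'k dbl2"
  have red: "(\<Sum>c\<in>Adm (subforest T S). ?h T S (pruning (subforest T S) c)) = (\<Sum>P\<in>?U T S. ?h T S P)"
    if "is_couple (T, S)" for T S
    using sum.reindex_bij_betw[OF couple_Adm_bij[OF that]] .
  from xy have c: "is_couple (T, S)" "is_couple (T', S')" by (auto simp: couple_iso.simps)
  obtain f where f: "bij_betw ((`) f) (?U T S) (?U T' S')"
    and isos: "\<And>P. P \<in> ?U T S \<Longrightarrow> couple_iso (T, P) (T', f ` P) \<and>
       couple_iso (subforest T (verts T - P), S - P) (subforest T' (verts T' - f ` P), S' - f ` P)"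
    using couple_iso_cut[of T S T' S'] xy by fastforce
  have "(\<Sum>P\<in>?U T S. ?h T S P) = (\<Sum>P\<in>?U T S. ?h T' S' (f ` P))"
  proof (rule sum.cong[OF refl])
    fix P assume "P \<in> ?U T S"
    from isos[OF this] show "?h T S P = ?h T' S' (f ` P)"
      by (simp only: abs_couple_eq[of "(T, P)" "(T', f ` P)"]
        abs_couple_eq[of "(subforest T (verts T - P), S - P)" "(subforest T' (verts T' - f ` P), S' - f ` P)"])
  qed
  also have "\<dots> = (\<Sum>P\<in>?U T' S'. ?h T' S' P)" using sum.reindex_bij_betw[OF f] .
  finally show "(case x of (T, S) \<Rightarrow> \<Sum>c\<in>Adm (subforest T S). let P = pruning (subforest T S) c in ?h T S P) =
      (case y of (T, S) \<Rightarrow> \<Sum>c\<in>Adm (subforest T S). let P = pruning (subforest T S) c in ?h T S P)"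
    using red c by (simp add: Let_def)
qed

definition coprod :: "'k::field dbl \<Rightarrow> 'k dbl2" where
  "coprod = alg_ext coprod_gen"

lift_definition counit_gen :: "couple \<Rightarrow> 'k::field" is
  "\<lambda>(T, S). if S = {} then 1 else 0"
  by (auto simp: couple_iso.simps)

definition counit :: "'k::field dbl \<Rightarrow> 'k" where
  "counit p = (\<Sum>M\<in>Poly_Mapping.keys p. Poly_Mapping.lookup p M * (\<Prod>x\<in>#M. counit_gen x))"

text \<open>The map \<open>\<epsilon> \<otimes> I\<close>, with values in \<open>k \<otimes> \<D>' = \<D>'\<close>.\<close>

definition counit_id :: "'k::field dbl2 \<Rightarrow> 'k dbl" where
  "counit_id = lin_ext (\<lambda>(a, b). Poly_Mapping.single b (counit (basis a)))"

end

theory Submission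
  imports Defs
begin

text \<open>All maps involved are algebra morphisms, so the identities need only be checked on a generator
  \<open>(T, S)\<close>. The cuts of \<open>S\<close> correspond to the subsets \<open>P\<close> of \<open>S\<close> closed under descendants, and
  both iterated coproducts become the sum of
  \<open>(T, Q) \<otimes> (T - Q, P - Q) \<otimes> (T - P, S - P)\<close> over chains \<open>Q \<subseteq> P \<subseteq> S\<close> of closed sets.\<close>

section \<open>Linear maps between free modules\<close>

abbreviation scale :: "'k \<Rightarrow> ('a \<Rightarrow>\<^sub>0 'k::field) \<Rightarrow> ('a \<Rightarrow>\<^sub>0 'k)" where
  "scale c \<equiv> Poly_Mapping.map ((*) c)"

lemma lookup_scale: "Poly_Mapping.lookup (scale c p) a = c * Poly_Mapping.lookup p a"
  by (simp add: Poly_Mapping.map.rep_eq when_def)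

definition linear_map :: "(('a \<Rightarrow>\<^sub>0 'k::field) \<Rightarrow> ('b \<Rightarrow>\<^sub>0 'k)) \<Rightarrow> bool" where
  "linear_map f \<longleftrightarrow> (\<forall>p q. f (p + q) = f p + f q) \<and> (\<forall>c p. f (scale c p) = scale c (f p))"

lemma linear_mapI:
  "(\<And>p q. f (p + q) = f p + f q) \<Longrightarrow> (\<And>c p. f (scale c p) = scale c (f p)) \<Longrightarrow> linear_map f"
  by (simp add: linear_map_def)

lemma linear_map_add: "linear_map f \<Longrightarrow> f (p + q) = f p + f q"
  by (simp add: linear_map_def)

lemma linear_map_scale: "linear_map f \<Longrightarrow> f (scale c p) = scale c (f p)"
  by (simp add: linear_map_def)

lemma linear_map_zero: "linear_map f \<Longrightarrow> f 0 = 0"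
  using linear_map_add[of f 0 0] by simp

lemma linear_map_sum:
  assumes "linear_map f"
  shows "f (\<Sum>i\<in>I. p i) = (\<Sum>i\<in>I. f (p i))"
  by (induction I rule: infinite_finite_induct)
    (simp_all add: linear_map_zero[OF assms] linear_map_add[OF assms])

text \<open>Induction on the support: every vector arises from 0 by assigning values at new keys,
  and each assignment adds a multiple of a basis vector.\<close>

lemma linear_map_eqI:
  fixes f g :: "('a \<Rightarrow>\<^sub>0 'k::field) \<Rightarrow> ('b \<Rightarrow>\<^sub>0 'k)"
  assumes f: "linear_map f" and g: "linear_map g" and eq: "\<And>a. f (basis a) = g (basis a)"
  shows "f p = g p"
proof (induction p rule: update_induct)
  case const
  then show ?case using linear_map_zero f g by metis
next
  case (update p a b)
  \<comment> \<open>Since \<open>a\<close> is not yet a key of \<open>p\<close>, the old coefficient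
    there is 0 and the update is an addition.\<close>
  have "Poly_Mapping.update a b p = p + scale b (basis a)"
    using update(1) by (intro poly_mapping_eqI)
      (auto simp: lookup_update lookup_add lookup_scale lookup_single when_def in_keys_iff)
  then have upd: "h (Poly_Mapping.update a b p) = h p + scale b (h (basis a))" if "linear_map h"
    for h :: "_ \<Rightarrow> 'b \<Rightarrow>\<^sub>0 'k"
    by (simp only: linear_map_add[OF that] linear_map_scale[OF that])
  show ?case using update(3) by (simp only: upd[OF f] upd[OF g] eq)
qed

lemma linear_map_id: "linear_map id"
  by (simp add: linear_map_def)

lemma linear_map_comp: "linear_map g \<Longrightarrow> linear_map f \<Longrightarrow> linear_map (g \<circ> f)"
  by (simp add: linear_map_def)

text \<open>\<open>lin_ext\<close> sums over the keys of its argument. A fixed finite superset gives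
  different arguments a common index set; the extra terms vanish.\<close>

lemma lin_ext_superset:
  assumes "finite A" "Poly_Mapping.keys p \<subseteq> A"
  shows "lin_ext f p = (\<Sum>a\<in>A. scale (Poly_Mapping.lookup p a) (f a))"
  unfolding lin_ext_def using assms
  by (intro sum.mono_neutral_left)
    (auto intro!: poly_mapping_eqI simp: lookup_scale in_keys_iff)

lemma linear_map_lin_ext:
  fixes f :: "'a \<Rightarrow> 'b \<Rightarrow>\<^sub>0 'k::field"
  shows "linear_map (lin_ext f)"
proof (rule linear_mapI)
  fix p q :: "'a \<Rightarrow>\<^sub>0 'k"
  let ?A = "Poly_Mapping.keys p \<union> Poly_Mapping.keys q"
  \<comment> \<open>Cancellation can make the keys of \<open>p + q\<close> fewer than
    \<open>?A\<close>, but they never leave it.\<close>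
  have "lin_ext f r = (\<Sum>a\<in>?A. scale (Poly_Mapping.lookup r a) (f a))" if "r \<in> {p, q, p + q}" for r
    using that Poly_Mapping.keys_add[of p q] by (intro lin_ext_superset) auto
  then show "lin_ext f (p + q) = lin_ext f p + lin_ext f q"
    by (auto intro!: poly_mapping_eqI
      simp: lookup_add lookup_sum lookup_scale distrib_right simp flip: sum.distrib)
next
  fix c and p :: "'a \<Rightarrow>\<^sub>0 'k"
  have "lin_ext f r = (\<Sum>a\<in>Poly_Mapping.keys p. scale (Poly_Mapping.lookup r a) (f a))"
    if "r \<in> {p, scale c p}" for r
    using that by (intro lin_ext_superset) (auto simp: in_keys_iff lookup_scale)
  then show "lin_ext f (scale c p) = scale c (lin_ext f p)"
    by (auto intro!: poly_mapping_eqI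
      simp: lookup_sum lookup_scale sum_distrib_left mult.assoc)
qed

lemma lin_ext_basis: "lin_ext f (basis a) = f a"
  by (auto intro!: poly_mapping_eqI simp: lin_ext_def lookup_scale)

section \<open>Tensor products of vectors and of linear maps\<close>

lemma lookup_tensor:
  "Poly_Mapping.lookup (tensor p q) (a, b) = Poly_Mapping.lookup p a * Poly_Mapping.lookup q b"
proof -
  have "Poly_Mapping.lookup (tensor p q) (a, b) =
      (\<Sum>x\<in>Poly_Mapping.keys p. \<Sum>y\<in>Poly_Mapping.keys q.
        if x = a then if y = b then Poly_Mapping.lookup p x * Poly_Mapping.lookup q y else 0 else 0)"
    unfolding tensor_def lookup_sum
    by (intro sum.cong) (auto simp: lookup_single when_def)
  \<comment> \<open>With the test on \<open>x\<close> outside the inner sum, two nested delta sums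
    remain; if \<open>a\<close> or \<open>b\<close> is not a key, its coefficient is 0
    anyway.\<close>
  also have "\<dots> = (\<Sum>x\<in>Poly_Mapping.keys p. if x = a then
        (\<Sum>y\<in>Poly_Mapping.keys q. if y = b then Poly_Mapping.lookup p x * Poly_Mapping.lookup q y else 0)
        else 0)"
    by (intro sum.cong) auto
  also have "\<dots> = Poly_Mapping.lookup p a * Poly_Mapping.lookup q b"
    by (simp add: in_keys_iff)
  finally show ?thesis .
qed

lemma poly_mapping_prod_eqI:
  "(\<And>a b. Poly_Mapping.lookup p (a, b) = Poly_Mapping.lookup q (a, b)) \<Longrightarrow> p = q"
  by (rule poly_mapping_eqI) (metis prod.exhaust)

lemma linear_map_tensor_left: "linear_map (\<lambda>p. tensor p q)"
  by (rule linear_mapI; rule poly_mapping_prod_eqI)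
    (auto simp: lookup_tensor lookup_add lookup_scale algebra_simps)

lemma linear_map_tensor_right: "linear_map (tensor p)"
  by (rule linear_mapI; rule poly_mapping_prod_eqI)
    (auto simp: lookup_tensor lookup_add lookup_scale algebra_simps)

lemma tensor_basis: "tensor (basis a) (basis b) = basis (a, b)"
  by (rule poly_mapping_prod_eqI) (auto simp: lookup_tensor lookup_single when_def)

lemma linear_map_tensor_map: "linear_map (f \<otimes> g)"
  unfolding tensor_map_def by (rule linear_map_lin_ext)

lemma tensor_map_basis: "(f \<otimes> g) (basis (a, b)) = tensor (f (basis a)) (g (basis b))"
  by (simp add: tensor_map_def lin_ext_basis)

lemma id_tensor_id: "id \<otimes> id = id"
  by (rule ext, rule linear_map_eqI[OF linear_map_tensor_map linear_map_id])
    (auto simp: tensor_map_def lin_ext_basis tensor_basis)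

section \<open>Algebra morphisms\<close>

lemma mult_basis:
  fixes a b :: "'a::comm_monoid_add"
  shows "basis a * basis b = (basis (a + b) :: 'a \<Rightarrow>\<^sub>0 'k::field)"
  by (simp add: mult_single)

text \<open>Scalars sit in the monoid algebra as multiples of the unit, the basis vector at 0.
  Linearity of multiplication then follows from the ring laws.\<close>

lemma scale_eq_mult:
  fixes p :: "'a::comm_monoid_add \<Rightarrow>\<^sub>0 'k::field"
  shows "scale c p = Poly_Mapping.single 0 c * p"
  by (rule poly_mapping_eqI)
    (simp add: lookup_scale mult_map_scale_conv_mult)

lemma linear_map_mult_left:
  fixes p :: "'a::comm_monoid_add \<Rightarrow>\<^sub>0 'k::field"
  shows "linear_map ((*) p)"
  by (rule linear_mapI) (simp_all add: scale_eq_mult algebra_simps)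

lemma linear_map_mult_right:
  fixes p :: "'a::comm_monoid_add \<Rightarrow>\<^sub>0 'k::field"
  shows "linear_map (\<lambda>q. q * p)"
  by (rule linear_mapI) (simp_all add: scale_eq_mult algebra_simps)

definition alg_hom ::
    "(('a::comm_monoid_add \<Rightarrow>\<^sub>0 'k::field) \<Rightarrow> ('b::comm_monoid_add \<Rightarrow>\<^sub>0 'k)) \<Rightarrow> bool" where
  "alg_hom f \<longleftrightarrow> linear_map f \<and> f 1 = 1 \<and> (\<forall>p q. f (p * q) = f p * f q)"

lemma alg_hom_linear: "alg_hom f \<Longrightarrow> linear_map f"
  by (simp add: alg_hom_def)

lemma alg_hom_one: "alg_hom f \<Longrightarrow> f 1 = 1"
  by (simp add: alg_hom_def)

lemma alg_hom_mult: "alg_hom f \<Longrightarrow> f (p * q) = f p * f q"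
  by (simp add: alg_hom_def)

lemma alg_hom_id: "alg_hom id"
  by (simp add: alg_hom_def linear_map_id)

lemma alg_hom_comp: "alg_hom g \<Longrightarrow> alg_hom f \<Longrightarrow> alg_hom (g \<circ> f)"
  by (simp add: alg_hom_def linear_map_comp)

lemma bilinear_eqI:
  assumes f: "\<And>q. linear_map (\<lambda>p. f p q)" "\<And>p. linear_map (f p)"
    and g: "\<And>q. linear_map (\<lambda>p. g p q)" "\<And>p. linear_map (g p)"
    and eq: "\<And>a b. f (basis a) (basis b) = g (basis a) (basis b)"
  shows "f p q = g p q"
  by (rule linear_map_eqI[OF f(1) g(1)], rule linear_map_eqI[OF f(2) g(2)], rule eq)

lemma linear_map_compose: "linear_map g \<Longrightarrow> linear_map f \<Longrightarrow> linear_map (\<lambda>p. g (f p))"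
  by (simp add: linear_map_def)

text \<open>Universal property of the monoid algebra: basis vectors multiply by adding indices, so a
  monoid morphism on indices extends to an algebra morphism. The structure maps built with
  \<open>lin_ext\<close> all have this shape.\<close>

lemma alg_hom_lin_ext:
  assumes one: "f 0 = 1" and add: "\<And>a b. f (a + b) = f a * f b"
  shows "alg_hom (lin_ext f)"
proof -
  have "lin_ext f (p * q) = lin_ext f p * lin_ext f q" for p q
    by (rule bilinear_eqI[where p = p and q = q])
      (auto intro: linear_map_compose[OF linear_map_lin_ext] linear_map_compose[OF _ linear_map_lin_ext]
        linear_map_mult_left linear_map_mult_right simp: mult_basis lin_ext_basis add)
  moreover have "lin_ext f 1 = 1"
    using lin_ext_basis[of f 0] one by (simp add: single_one)
  ultimately show ?thesis by (simp add: alg_hom_def linear_map_lin_ext)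
qed

lemma alg_hom_alg_ext: "alg_hom (alg_ext f)"
  unfolding alg_ext_def by (rule alg_hom_lin_ext) simp_all

lemma alg_ext_gen: "alg_ext f (gen x) = f x"
  by (simp add: alg_ext_def lin_ext_basis)

text \<open>Uniqueness half of the universal property of the symmetric algebra: a monomial is a
  product of generators. This reduces the theorem to generators.\<close>

lemma alg_hom_eqI:
  fixes f g :: "('a, 'k::field) sym_alg \<Rightarrow> ('b::comm_monoid_add \<Rightarrow>\<^sub>0 'k)"
  assumes f: "alg_hom f" and g: "alg_hom g" and eq: "\<And>x. f (gen x) = g (gen x)"
  shows "f = g"
proof (rule ext, rule linear_map_eqI[OF alg_hom_linear[OF f] alg_hom_linear[OF g]])
  fix M
  show "f (basis M) = g (basis M)"
  proof (induction M)
    case empty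
    then show ?case using f g by (simp add: alg_hom_one single_one)
  next
    case (add x M)
    have "basis (add_mset x M) = gen x * (basis M :: ('a, 'k) sym_alg)" by (simp add: mult_basis)
    with add show ?case by (simp add: alg_hom_mult[OF f] alg_hom_mult[OF g] eq)
  qed
qed

section \<open>Tensor products of algebras and the structure maps\<close>

lemma tensor_one: "tensor 1 1 = 1"
  using tensor_basis[of 0 0] by (simp add: single_one flip: zero_prod_def)

text \<open>On basis vectors this says that pairs of indices add componentwise; multilinearity does
  the rest, two arguments at a time.\<close>

lemma tensor_mult:
  fixes p p' :: "'a::comm_monoid_add \<Rightarrow>\<^sub>0 'k::field" and q q' :: "'b::comm_monoid_add \<Rightarrow>\<^sub>0 'k"
  shows "tensor (p * p') (q * q') = tensor p q * tensor p' q'"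
proof (rule bilinear_eqI[where p = p and q = q])
  fix a b
  show "tensor (basis a * p') (basis b * q') = tensor (basis a) (basis b) * tensor p' q'"
    by (rule bilinear_eqI[where p = p' and q = q'])
      (auto intro: linear_map_compose[OF linear_map_tensor_left linear_map_mult_left]
        linear_map_compose[OF linear_map_tensor_right linear_map_mult_left]
        linear_map_compose[OF linear_map_mult_left linear_map_tensor_left]
        linear_map_compose[OF linear_map_mult_left linear_map_tensor_right]
        simp: mult_basis tensor_basis)
qed (auto intro: linear_map_compose[OF linear_map_tensor_left linear_map_mult_right]
        linear_map_compose[OF linear_map_tensor_right linear_map_mult_right]
        linear_map_compose[OF linear_map_mult_right linear_map_tensor_left]
        linear_map_compose[OF linear_map_mult_right linear_map_tensor_right])

lemma alg_hom_tensor_map: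
  assumes f: "alg_hom f" and g: "alg_hom g"
  shows "alg_hom (f \<otimes> g)"
  unfolding tensor_map_def
proof (rule alg_hom_lin_ext)
  show "(case 0 of (a, b) \<Rightarrow> tensor (f (basis a)) (g (basis b))) = 1"
    by (simp add: zero_prod_def single_one alg_hom_one[OF f] alg_hom_one[OF g] tensor_one)
qed (auto simp: tensor_mult alg_hom_mult[OF f] alg_hom_mult[OF g] simp flip: mult_basis)

lemma alg_hom_assoc: "alg_hom assoc"
  unfolding assoc_def
  by (rule alg_hom_lin_ext) (auto simp: mult_basis zero_prod_def simp flip: single_one)

lemma alg_hom_tau23: "alg_hom tau23"
  unfolding tau23_def
  by (rule alg_hom_lin_ext) (auto simp: mult_basis zero_prod_def simp flip: single_one)

text \<open>Commutativity of the symmetric algebra enters here: \<open>(a + a') + (b + b')\<close>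
  equals \<open>(a + b) + (a' + b')\<close>.\<close>

lemma alg_hom_mult_map: "alg_hom mult"
  unfolding mult_def
  by (rule alg_hom_lin_ext) (auto simp: mult_basis zero_prod_def ac_simps simp flip: single_one)

lemma counit_basis: "counit (basis M) = (\<Prod>x\<in>#M. counit_gen x)"
  by (simp add: counit_def)

text \<open>The counit of a monomial is a product over its generators, hence multiplicative in the
  monomial.\<close>

lemma alg_hom_counit_id: "alg_hom counit_id"
  unfolding counit_id_def
  by (rule alg_hom_lin_ext)
    (auto simp: counit_basis mult_single zero_prod_def simp flip: single_one)

section \<open>The coaction on generators\<close>

abbreviation prune :: "forest \<Rightarrow> nat set \<Rightarrow> forest" where
  "prune T P \<equiv> subforest T (verts T - P)"

definition closed_subsets :: "forest \<Rightarrow> nat set \<Rightarrow> nat set set" where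
  "closed_subsets T S = {P. P \<subseteq> S \<and> edges T `` P \<subseteq> P}"

text \<open>The quotient is by a partial relation, reflexive exactly on couples; the chosen
  representative is related to itself and so is a couple.\<close>

lemma couple_cases:
  obtains T S where "is_couple (T, S)" "x = abs_couple (T, S)"
proof -
  obtain T S where "rep_couple x = (T, S)" by (metis prod.exhaust)
  then have "couple_iso (T, S) (T, S)" "x = abs_couple (T, S)"
    using Quotient3_rep_reflp[OF Quotient3_couple, of x] Quotient3_abs_rep[OF Quotient3_couple, of x]
    by simp_all
  then show thesis using that couple_iso.simps by blast
qed

lemma couple_iso_refl: "is_couple x \<Longrightarrow> couple_iso x x"
  by (cases x) (auto simp: couple_iso.simps prod.map_id0 intro!: exI[of _ id])

text \<open>A cut enters the coproduct only through its pruning, so the sum can be reindexed along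
  \<open>couple_Adm_bij\<close>.\<close>

lemma coprod_gen:
  assumes "is_couple (T, S)"
  shows "coprod (gen (abs_couple (T, S))) =
    (\<Sum>P\<in>closed_subsets T S. basis ({#abs_couple (T, P)#}, {#abs_couple (prune T P, S - P)#}))"
proof -
  let ?h = "\<lambda>P. basis ({#abs_couple (T, P)#}, {#abs_couple (prune T P, S - P)#})"
  have "coprod (gen (abs_couple (T, S))) =
      (\<Sum>c\<in>Adm (subforest T S). ?h (pruning (subforest T S) c))"
    unfolding coprod_def alg_ext_gen
    using coprod_gen.abs_eq[of "(T, S)"] couple_iso_refl[OF assms]
    by (simp add: Let_def tensor_basis)
  also have "\<dots> = (\<Sum>P\<in>closed_subsets T S. ?h P)"
    unfolding closed_subsets_def by (rule sum.reindex_bij_betw[OF couple_Adm_bij[OF assms]])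
  finally show ?thesis .
qed

lemma alg_hom_coprod: "alg_hom coprod"
  unfolding coprod_def by (rule alg_hom_alg_ext)

lemma alg_hom_unshuffle: "alg_hom unshuffle"
  unfolding unshuffle_def by (rule alg_hom_alg_ext)

lemma finite_closed_subsets: "is_couple (T, S) \<Longrightarrow> finite (closed_subsets T S)"
  by (rule finite_subset[of _ "Pow (verts T)"])
    (auto simp: closed_subsets_def is_couple_iff is_tree_def is_forest_def)

text \<open>Both factors of each term of the coproduct are couples again, so
  \<open>coprod_gen\<close> applies a second time to either.\<close>

lemma closed_subsets_couple:
  assumes "is_couple (T, S)" "P \<in> closed_subsets T S"
  shows "is_couple (T, P)" "is_couple (prune T P, S - P)"
  using couple_prune[OF assms(1)] assms(2) by (auto simp: closed_subsets_def)

section \<open>Coassociativity\<close>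

lemma prune_prune: "prune (prune T Q) R = prune T (Q \<union> R)"
  by (auto simp: subforest_def)

text \<open>On the left the larger set \<open>P\<close> is chosen first and \<open>Q\<close> inside
  it; on the right \<open>Q\<close> comes first, then \<open>R\<close> in the remaining couple. The
  substitution \<open>R = P - Q\<close> matches the two double sums.\<close>

lemma coprod_coassoc_gen:
  assumes c: "is_couple (T, S)"
  shows "(assoc \<circ> (coprod \<otimes> id) \<circ> coprod) (gen (abs_couple (T, S))) =
    (id \<otimes> coprod) (coprod (gen (abs_couple (T, S))) :: 'k::field dbl2)"
proof -
  let ?C = "\<lambda>T S. {#abs_couple (T, S)#}"
  let ?U = closed_subsets
  let ?b = "\<lambda>Q P. basis (?C T Q, ?C (prune T Q) (P - Q), ?C (prune T P) (S - P))
    :: couple multiset \<times> couple multiset \<times> couple multiset \<Rightarrow>\<^sub>0 'k"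
  from c have E: "edges T \<subseteq> verts T \<times> verts T"
    by (auto simp: is_couple_iff is_tree_def is_forest_def)
  have inner: "(coprod \<otimes> id) (basis (?C T P, M) :: 'k dbl2) =
      (\<Sum>Q\<in>?U T P. basis ((?C T Q, ?C (prune T Q) (P - Q)), M))"
    if "P \<in> ?U T S" for P M
    using closed_subsets_couple(1)[OF c that]
    by (simp add: tensor_map_basis coprod_gen linear_map_sum[OF linear_map_tensor_left] tensor_basis)
  have "(assoc \<circ> (coprod \<otimes> id) \<circ> coprod) (gen (abs_couple (T, S))) =
      (\<Sum>P\<in>?U T S. \<Sum>Q\<in>?U T P. ?b Q P)"
    by (simp add: coprod_gen[OF c] inner linear_map_sum[OF linear_map_tensor_map]
        assoc_def lin_ext_basis linear_map_sum[OF linear_map_lin_ext] cong: sum.cong)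
  also have "\<dots> = (\<Sum>(P, Q)\<in>Sigma (?U T S) (?U T). ?b Q P)"
    by (intro sum.Sigma ballI finite_closed_subsets[OF c]
        finite_closed_subsets[OF closed_subsets_couple(1)[OF c]])
  also have "\<dots> = (\<Sum>(Q, R)\<in>(SIGMA Q:?U T S. ?U (prune T Q) (S - Q)).
      basis (?C T Q, ?C (prune T Q) R, ?C (prune (prune T Q) R) (S - Q - R)))"
  \<comment> \<open>The maps invert each other (cases 1 and 3), respect the index sets (2 and 4),
    and the summands agree (5).\<close>
  proof (rule sum.reindex_bij_witness[of _ "\<lambda>(Q, R). (Q \<union> R, Q)" "\<lambda>(P, Q). (Q, P - Q)"], goal_cases)
    case (1 a)
    then show ?case by (auto simp: closed_subsets_def)
  next
    case (2 a)
    \<comment> \<open>No edge of \<open>prune T Q\<close> ends in \<open>Q\<close>, so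
      \<open>P - Q\<close> is closed there.\<close>
    have "Q \<in> ?U T S \<and> P - Q \<in> ?U (prune T Q) (S - Q)" if "P \<in> ?U T S" "Q \<in> ?U T P" for P Q
      using that unfolding closed_subsets_def subforest_def by auto
    with 2 show ?case by auto
  next
    case (3 a)
    then show ?case by (auto simp: closed_subsets_def)
  next
    case (4 a)
    \<comment> \<open>An edge out of \<open>R\<close> that does not end in \<open>Q\<close> survives
      in \<open>prune T Q\<close>, where \<open>R\<close> is closed; hence
      \<open>Q \<union> R\<close> is closed in \<open>T\<close>.\<close>
    have "Q \<union> R \<in> ?U T S \<and> Q \<in> ?U T (Q \<union> R)"
      if Q: "Q \<in> ?U T S" and R: "R \<in> ?U (prune T Q) (S - Q)" for Q R
    proof -
      have "v \<in> Q \<union> R" if "u \<in> R" "(u, v) \<in> edges T" for u v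
      proof (cases "v \<in> Q")
        case False
        have "u \<notin> Q" using R that(1) by (auto simp: closed_subsets_def)
        then have "(u, v) \<in> edges (prune T Q)" using False that(2) E by (auto simp: subforest_def)
        then show ?thesis using R that(1) by (auto simp: closed_subsets_def)
      qed simp
      then show ?thesis using Q R by (auto simp: closed_subsets_def)
    qed
    with 4 show ?case by auto
  next
    case (5 a)
    \<comment> \<open>Pruning \<open>Q\<close> and then \<open>P - Q\<close> removes exactly
      \<open>P\<close>, so the third factors agree.\<close>
    have "Q \<union> (P - Q) = P \<and> S - Q - (P - Q) = S - P" if "Q \<subseteq> P" for P Q
      using that by blast
    with 5 show ?case by (auto simp: prune_prune closed_subsets_def simp del: Un_Diff_cancel)
  qed
  also have "\<dots> = (\<Sum>Q\<in>?U T S. \<Sum>R\<in>?U (prune T Q) (S - Q).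
      basis (?C T Q, ?C (prune T Q) R, ?C (prune (prune T Q) R) (S - Q - R)))"
    by (intro sum.Sigma[symmetric] ballI finite_closed_subsets[OF c]
        finite_closed_subsets[OF closed_subsets_couple(2)[OF c]])
  also have "\<dots> = (id \<otimes> coprod) (coprod (gen (abs_couple (T, S))) :: 'k dbl2)"
    using closed_subsets_couple(2)[OF c]
    by (simp add: coprod_gen[OF c] linear_map_sum[OF linear_map_tensor_map] tensor_map_basis
        coprod_gen linear_map_sum[OF linear_map_tensor_right] tensor_basis cong: sum.cong)
  finally show ?thesis .
qed

section \<open>The counit axiom\<close>

lemma counit_gen_abs:
  assumes "is_couple (T, S)"
  shows "counit_gen (abs_couple (T, S)) = (if S = {} then 1 else 0)"
  using counit_gen.abs_eq[of "(T, S)"] couple_iso_refl[OF assms] by simp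

text \<open>The counit kills every term with nonempty pruning; the term of the empty set remains and
  removes nothing from the tree.\<close>

lemma counit_coprod_gen:
  assumes c: "is_couple (T, S)"
  shows "counit_id (coprod (gen (abs_couple (T, S)))) = gen (abs_couple (T, S))"
proof -
  let ?C = "\<lambda>P. {#abs_couple (prune T P, S - P)#}"
  have T: "subforest T (verts T) = T"
    using c by (auto simp: is_couple_iff is_tree_def is_forest_def subforest_def prod_eq_iff)
  have "counit_id (coprod (gen (abs_couple (T, S)))) =
      (\<Sum>P\<in>closed_subsets T S. Poly_Mapping.single (?C P) (if P = {} then 1 else 0))"
    using closed_subsets_couple(1)[OF c]
    by (simp add: counit_gen_abs coprod_gen[OF c] linear_map_sum[OF alg_hom_linear[OF alg_hom_counit_id]]
        counit_id_def lin_ext_basis counit_basis linear_map_sum[OF linear_map_lin_ext] cong: sum.cong)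
  also have "\<dots> = (\<Sum>P\<in>closed_subsets T S. if P = {} then gen (abs_couple (T, S)) else 0)"
    by (intro sum.cong) (simp_all add: T)
  also have "\<dots> = gen (abs_couple (T, S))"
    using finite_closed_subsets[OF c] by (simp add: closed_subsets_def)
  finally show ?thesis .
qed

section \<open>Compatibility with unshuffling, and the theorem\<close>

lemma unshuffle_gen: "unshuffle (gen x) = basis ({#x#}, {#}) + basis ({#}, {#x#})"
  by (simp add: unshuffle_def alg_ext_gen tensor_basis flip: single_one)

text \<open>Generators are primitive for \<open>unshuffle\<close> and \<open>coprod\<close>
  preserves the unit, so both sides are the sum over \<open>P\<close> of \<open>(T, P)\<close>
  tensored with the unshuffling of the pruned couple. In each product formed by \<open>mult\<close>
  one factor is the unit.\<close>

lemma unshuffle_coprod_gen: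
  assumes c: "is_couple (T, S)"
  shows "(id \<otimes> unshuffle) (coprod (gen (abs_couple (T, S)))) =
    (mult \<otimes> (id \<otimes> id)) (tau23 ((coprod \<otimes> coprod) (unshuffle (gen (abs_couple (T, S))))))"
proof -
  \<comment> \<open>The unit of the symmetric algebra is the basis vector at the empty
    multiset.\<close>
  have one: "coprod (basis {#}) = basis ({#}, {#})"
    using alg_hom_one[OF alg_hom_coprod] by (simp add: zero_prod_def del: single_one flip: single_one)
  have tau: "tau23 (basis ((a, b), (c, d))) = basis ((a, c), (b, d))" for a b c d :: "couple multiset"
    by (simp add: tau23_def lin_ext_basis)
  have mul: "mult (basis (a, b)) = basis (a + b)" for a b :: "couple multiset"
    by (simp add: mult_def lin_ext_basis mult_basis)
  show ?thesis
    by (simp del: single_one add: unshuffle_gen tensor_map_basis coprod_gen[OF c] one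
        tensor_basis id_tensor_id tau mul
        linear_map_add[OF linear_map_tensor_map] linear_map_sum[OF linear_map_tensor_map]
        linear_map_sum[OF linear_map_tensor_left] linear_map_sum[OF linear_map_tensor_right]
        linear_map_add[OF linear_map_tensor_right]
        linear_map_add[OF alg_hom_linear[OF alg_hom_tau23]]
        linear_map_sum[OF alg_hom_linear[OF alg_hom_tau23]] sum.distrib)
qed

text \<open>The first two clauses are the axioms of a left coaction, counitality included. Only the
  first needs \<open>assoc\<close>; both sides of the third are indexed by triples nested in the
  same way.\<close>

theorem theorem6:
  shows "assoc \<circ> (coprod \<otimes> id) \<circ> coprod =
      (id \<otimes> coprod) \<circ> (coprod :: 'k::field dbl \<Rightarrow> 'k dbl2) \<and>
    counit_id \<circ> coprod = (id :: 'k dbl \<Rightarrow> 'k dbl) \<and>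
    (id \<otimes> unshuffle) \<circ> coprod =
      (mult \<otimes> (id \<otimes> id)) \<circ> tau23 \<circ> (coprod \<otimes> coprod) \<circ>
        (unshuffle :: 'k dbl \<Rightarrow> 'k dbl2)"
proof (intro conjI; rule alg_hom_eqI)
  \<comment> \<open>Both sides of each identity are algebra morphisms, as the closing step checks
    factor by factor, so a generator represented by a couple suffices.\<close>
  fix x
  show "(assoc \<circ> (coprod \<otimes> id) \<circ> coprod) (gen x) =
      ((id \<otimes> coprod) \<circ> (coprod :: 'k dbl \<Rightarrow> 'k dbl2)) (gen x)"
    using coprod_coassoc_gen by (cases x rule: couple_cases) simp
  show "(counit_id \<circ> coprod) (gen x) = (id :: 'k dbl \<Rightarrow> 'k dbl) (gen x)"
    using counit_coprod_gen by (cases x rule: couple_cases) simp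
  show "((id \<otimes> unshuffle) \<circ> coprod) (gen x) =
      ((mult \<otimes> (id \<otimes> id)) \<circ> tau23 \<circ> (coprod \<otimes> coprod) \<circ>
        (unshuffle :: 'k dbl \<Rightarrow> 'k dbl2)) (gen x)"
    using unshuffle_coprod_gen by (cases x rule: couple_cases) simp
qed (intro alg_hom_comp alg_hom_tensor_map alg_hom_id alg_hom_assoc alg_hom_coprod
    alg_hom_counit_id alg_hom_unshuffle alg_hom_mult_map alg_hom_tau23)+

end
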